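(* Let $f:\mathbb{R}^d\to\mathbb{R}\cup\{\infty\}$ be convex and $\ell$-smooth, attaining its minimum at $x^*\in\mathbb{R}^d$, and let $x^0\in\mathcal{X}$. Suppose that $\psi:\mathbb{R}_+\to\mathbb{R}_+$, $\psi(x)=\frac{x^2}{2\ell(4x)}$, is strictly increasing, and let $\bar R>0$ satisfy $\bar R\ge R:=\|x^0-x^*\|$. Let $\varepsilon>0$. Then for every $\delta\ge 0$ such that $\ell\left(8\sqrt{\delta\,\ell(0)}\right)\le 2\ell(0)$, the oracle complexity (number of gradient calls) required by Algorithm 1 with parameters $\delta,\bar R$ to find an $\varepsilon$-solution is at most (rounded up to an integer) $$\frac{5\sqrt{\ell(0)}\,\bar R}{\sqrt{\varepsilon}}+k(\delta),\qquad k(\delta):=\max\left\{1+\frac12\log_{3/2}\left(\frac{\delta}{8\ell(0)\bar R^2}\right),0\right\}+k_{\mathrm{GD}}(\delta),$$ where $k_{\mathrm{GD}}(\delta)$ is the oracle complexity of GD (Phase 1 of Algorithm 1, started at $x^0$) for finding a point $\bar x$ such that $f(\bar x)-f(x^* )\le\delta/2$.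
   Context: $\|\cdot\|$ is the Euclidean norm for vectors and the spectral norm for matrices; $\mathbb{R}_+=[0,\infty)$. An $\varepsilon$-solution is a point $\bar x\in\mathbb{R}^d$ with $f(\bar x)-\inf_{x} f(x)\le\varepsilon$. Setting: $f:\mathbb{R}^d\to\mathbb{R}\cup\{\infty\}$, $\mathcal{X}:=\{x\in\mathbb{R}^d: f(x)<\infty\}$ is assumed to be an open, $d$-dimensional (nonempty) convex set, and $\bar{\mathcal{X}}$ denotes its closure; $\mathrm{Proj}_{\bar{\mathcal{X}}}$ is the Euclidean projection onto $\bar{\mathcal{X}}$. $f$ is $\ell$-smooth if $f$ is twice differentiable on $\mathcal{X}$, continuous on $\bar{\mathcal{X}}$, and $\ell:[0,\infty)\to(0,\infty)$ is a non-decreasing, positive, locally Lipschitz function with $\|\nabla^2 f(x)\|\le \ell(\|\nabla f(x)\|)$ for all $x\in\mathcal{X}$. Algorithm 1 (input: $x^0\in\mathcal{X}$, $\ell$, $\delta$, $\bar R$). Phase 1: starting from $x^0$, run gradient descent (GD) $x^{j+1}=x^j-\eta_j\nabla f(x^j)$ with $\eta_j=\int_0^1\frac{dv}{\ell(\|\nabla f(x^j)\|+\|\nabla f(x^j)\|v)}$ until a point $\bar x$ with $f(\bar x)-f(x^* )\le\delta/2$ is reached. Phase 2: set $y^0=u^0=\bar x$, $\Gamma_0=\delta/\bar R^2$, $\gamma=1/(2\ell(0))$, and for $k=0,1,2,\dots$: $\alpha_k=\sqrt{\gamma\Gamma_k}$; $y^{k+1}=\frac{1}{1+\alpha_k}y^k+\frac{\alpha_k}{1+\alpha_k}u^k-\frac{\gamma}{1+\alpha_k}\nabla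 f(y^k)$; $u^{k+1}=\mathrm{Proj}_{\bar{\mathcal{X}}}\left(u^k-\frac{\alpha_k}{\Gamma_k}\nabla f(y^{k+1})\right)$; $\Gamma_{k+1}=\Gamma_k/(1+\alpha_k)$. One new gradient is computed per iteration. Conventions for the degenerate value $\delta=0$: $\log 0=-\infty$, $k_{\mathrm{GD}}(0)=\infty$ if GD does not reach a minimizer in finitely many steps (the bound is then vacuous), and if it does, the point $\bar x$ is already an $\varepsilon$-solution. *)

theory Defs
  imports "HOL-Analysis.Analysis"
begin

definition eff_domain :: "(real ^ 'd \<Rightarrow> ereal) \<Rightarrow> (real ^ 'd) set" where
  "eff_domain f = {x. f x < \<infinity>}"

(* Since 0 * \<infinity> = 0 in ereal, the endpoints u = 0 and u = 1 impose nothing. *)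
definition convex_fun :: "(real ^ 'd \<Rightarrow> ereal) \<Rightarrow> bool" where
  "convex_fun f \<longleftrightarrow> (\<forall>x y u. 0 \<le> u \<longrightarrow> u \<le> 1 \<longrightarrow>
     f (u *\<^sub>R x + (1 - u) *\<^sub>R y) \<le> ereal u * f x + ereal (1 - u) * f y)"

(* The gradient is only meaningful at points of the (open) effective domain,
   where the real part agrees with f in a neighbourhood. *)
definition gradient :: "(real ^ 'd \<Rightarrow> ereal) \<Rightarrow> real ^ 'd \<Rightarrow> real ^ 'd" where
  "gradient f x = (THE g. GDERIV (\<lambda>z. real_of_ereal (f z)) x :> g)"

definition hessian :: "(real ^ 'd \<Rightarrow> ereal) \<Rightarrow> real ^ 'd \<Rightarrow> real ^ 'd ^ 'd" where
  "hessian f x = jacobian (gradient f) (at x)"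

definition spectral_norm :: "real ^ 'd ^ 'd \<Rightarrow> real" where
  "spectral_norm A = onorm (\<lambda>v. A *v v)"

definition twice_differentiable_on_domain :: "(real ^ 'd \<Rightarrow> ereal) \<Rightarrow> bool" where
  "twice_differentiable_on_domain f \<longleftrightarrow>
     (\<forall>x\<in>eff_domain f. (\<lambda>z. real_of_ereal (f z)) differentiable (at x)) \<and>
     (\<forall>x\<in>eff_domain f. gradient f differentiable (at x))"

(* Functions on [0,\<infinity>) are functions on real of which only the values on {0..} matter.
   Continuity on the closure is with respect to the topology of the extended reals:
   f = \<infinity> on the boundary of the effective domain, so f tends to \<infinity> there. *)
definition ell_smooth :: "(real \<Rightarrow> real) \<Rightarrow> (real ^ 'd \<Rightarrow> ereal) \<Rightarrow> bool" where
  "ell_smooth l f \<longleftrightarrow>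
     twice_differentiable_on_domain f \<and>
     continuous_on (closure (eff_domain f)) f \<and>
     mono_on {0..} l \<and> (\<forall>s\<ge>0. l s > 0) \<and>
     local_lipschitz (UNIV :: real set) {0..} (\<lambda>_. l) \<and>
     (\<forall>x\<in>eff_domain f. spectral_norm (hessian f x) \<le> l (norm (gradient f x)))"

definition eps_solution :: "(real ^ 'd \<Rightarrow> ereal) \<Rightarrow> real \<Rightarrow> real ^ 'd \<Rightarrow> bool" where
  "eps_solution f \<epsilon> x \<longleftrightarrow> f x - (INF z. f z) \<le> ereal \<epsilon>"

definition gd_step_size :: "(real ^ 'd \<Rightarrow> ereal) \<Rightarrow> (real \<Rightarrow> real) \<Rightarrow> real ^ 'd \<Rightarrow> real" where
  "gd_step_size f l x =
     integral {0..1} (\<lambda>v. 1 / l (norm (gradient f x) + norm (gradient f x) * v))"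

primrec gd :: "(real ^ 'd \<Rightarrow> ereal) \<Rightarrow> (real \<Rightarrow> real) \<Rightarrow> real ^ 'd \<Rightarrow> nat \<Rightarrow> real ^ 'd" where
  "gd f l x0 0 = x0"
| "gd f l x0 (Suc j) =
     gd f l x0 j - gd_step_size f l (gd f l x0 j) *\<^sub>R gradient f (gd f l x0 j)"

(* Least number of gradient calls after which gradient descent is within \<delta>/2 of the minimal
   value: the j-th iterate uses exactly the j gradients at iterates 0, ..., j - 1.
   The value is \<infinity> (Inf of the empty set) if no iterate qualifies. *)
definition k_GD ::
  "(real ^ 'd \<Rightarrow> ereal) \<Rightarrow> (real \<Rightarrow> real) \<Rightarrow> real ^ 'd \<Rightarrow> real ^ 'd \<Rightarrow> real \<Rightarrow> enat" where
  "k_GD f l x0 xstar \<delta> =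
     Inf {enat j | j. f (gd f l x0 j) - f xstar \<le> ereal (\<delta> / 2)}"

(* The triple (y^k, u^k, \<Gamma>_k) of the accelerated phase.  For \<delta> = 0 one has \<Gamma>_k = 0 and the
   quotient \<alpha>_k / \<Gamma>_k is 0 by the convention x / 0 = 0. *)
primrec phase2 ::
  "(real ^ 'd \<Rightarrow> ereal) \<Rightarrow> (real \<Rightarrow> real) \<Rightarrow> real \<Rightarrow> real \<Rightarrow> real ^ 'd \<Rightarrow> nat
     \<Rightarrow> (real ^ 'd) \<times> (real ^ 'd) \<times> real" where
  "phase2 f l \<delta> Rbar xbar 0 = (xbar, xbar, \<delta> / Rbar\<^sup>2)"
| "phase2 f l \<delta> Rbar xbar (Suc k) =
     (let (y, u, \<Gamma>) = phase2 f l \<delta> Rbar xbar k;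
          \<gamma> = 1 / (2 * l 0);
          \<alpha> = sqrt (\<gamma> * \<Gamma>);
          y' = (1 / (1 + \<alpha>)) *\<^sub>R y + (\<alpha> / (1 + \<alpha>)) *\<^sub>R u
                 - (\<gamma> / (1 + \<alpha>)) *\<^sub>R gradient f y;
          u' = closest_point (closure (eff_domain f)) (u - (\<alpha> / \<Gamma>) *\<^sub>R gradient f y')
      in (y', u', \<Gamma> / (1 + \<alpha>)))"

(* Least number of gradient calls after which the algorithm (gradient descent up to the first
   iterate xbar within \<delta>/2 of the minimal value, then the accelerated phase started at xbar)
   has produced an \<epsilon>-solution y^N.  Computing y^N takes, besides the k_GD calls of the first
   phase, the N gradients at y^0, ..., y^{N-1}.  All queried points are required to lie in the
   effective domain, so that no meaningless gradient value is ever used.  If the first phase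
   does not terminate, the value is \<infinity>. *)
definition alg1_complexity ::
  "(real ^ 'd \<Rightarrow> ereal) \<Rightarrow> (real \<Rightarrow> real) \<Rightarrow> real ^ 'd \<Rightarrow> real ^ 'd \<Rightarrow> real \<Rightarrow> real \<Rightarrow> real
     \<Rightarrow> enat" where
  "alg1_complexity f l x0 xstar \<delta> Rbar \<epsilon> =
     (let K = k_GD f l x0 xstar \<delta>;
          xbar = gd f l x0 (the_enat K);
          y = (\<lambda>k. fst (phase2 f l \<delta> Rbar xbar k))
      in Inf {K + enat N | N.
           (\<forall>j. enat j < K \<longrightarrow> gd f l x0 j \<in> eff_domain f) \<and>
           (\<forall>k<N. y k \<in> eff_domain f) \<and>
           eps_solution f \<epsilon> (y N)})"

(* Logarithm of a nonnegative real with log 0 = -\<infinity>. *)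
definition elog :: "real \<Rightarrow> real \<Rightarrow> ereal" where
  "elog b x = (if x = 0 then -\<infinity> else ereal (log b x))"

definition k_bound ::
  "(real ^ 'd \<Rightarrow> ereal) \<Rightarrow> (real \<Rightarrow> real) \<Rightarrow> real ^ 'd \<Rightarrow> real ^ 'd \<Rightarrow> real \<Rightarrow> real \<Rightarrow> ereal" where
  "k_bound f l x0 xstar Rbar \<delta> =
     max (1 + ereal (1 / 2) * elog (3 / 2) (\<delta> / (8 * l 0 * Rbar\<^sup>2))) 0
       + ereal_of_enat (k_GD f l x0 xstar \<delta>)"

(* Rounding up to the next natural number, with \<infinity> rounded to \<infinity>. *)
definition round_up :: "ereal \<Rightarrow> enat" where
  "round_up x = Inf {n. x \<le> ereal_of_enat n}"

end

theory Submission
  imports Defs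
begin

text \<open>
  Write \<open>g\<close> for the gradient and \<open>q a p = \<integral>\<^sub>0\<^sup>p dw / l (a + w)\<close>. Along a straight path from \<open>x\<close>
  of length at most \<open>q \<bar>g x\<bar> M\<close>, the gradient moves by at most \<open>M\<close>; hence \<open>f\<close> stays bounded and the
  path cannot leave the domain. Following such a path from \<open>x\<close> in the direction \<open>g y - g x\<close> gives
  cocoercivity with the local constant \<open>l (\<bar>g x\<bar> + \<bar>g x - g y\<bar>)\<close>. Cocoercivity against the minimizer
  shows that gradient descent does not increase the distance to it.

  In the accelerated phase, monotonicity of \<open>\<psi>\<close> turns a gap below \<open>\<delta>\<close> into a gradient bound under
  which the effective smoothness constant is \<open>2 * l 0\<close>. Then
  \<open>f y - f x\<^sup>* - \<gamma> / 2 * \<bar>g y\<bar>\<^sup>2 + \<Gamma> / 2 * \<bar>u - x\<^sup>*\<bar>\<^sup>2\<close> shrinks by the factor \<open>1 / (1 + \<alpha>)\<close> in every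
  step, just like \<open>\<Gamma>\<close>, so the gap after \<open>N\<close> steps is at most \<open>Rbar\<^sup>2 * \<Gamma>\<^sub>N\<close>. Finally
  \<open>\<alpha>\<close> decays geometrically as long as \<open>\<alpha> > 2\<close>, and from then on \<open>1 / \<alpha>\<close> grows linearly.
\<close>

section \<open>Induction over a real interval and an inner product identity\<close>

text \<open>If some point failed, let \<open>c\<close> be the infimum of the failing points:
  \<open>base\<close> or \<open>left\<close> gives \<open>P c\<close>, and \<open>right\<close> then
  keeps the failing points a positive distance beyond \<open>c\<close>.\<close>

lemma real_induction:
  fixes P :: "real \<Rightarrow> bool"
  assumes base: "P 0"
    and right: "\<And>s. 0 \<le> s \<Longrightarrow> s < T \<Longrightarrow> P s \<Longrightarrow> \<exists>e>0. \<forall>r. s < r \<and> r < s + e \<longrightarrow> P r"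
    and left: "\<And>s. 0 < s \<Longrightarrow> s \<le> T \<Longrightarrow> (\<And>r. 0 \<le> r \<Longrightarrow> r < s \<Longrightarrow> P r) \<Longrightarrow> P s"
    and s: "0 \<le> s" "s \<le> T"
  shows "P s"
proof (rule ccontr)
  assume "\<not> P s"
  define B where "B = {r. 0 \<le> r \<and> r \<le> T \<and> \<not> P r}"
  have ne: "B \<noteq> {}" and bdd: "bdd_below B"
    using \<open>\<not> P s\<close> s by (auto simp: B_def)
  define c where "c = Inf B"
  have c0: "0 \<le> c"
    unfolding c_def using ne by (intro cInf_greatest) (auto simp: B_def)
  have cT: "c \<le> T"
    using cInf_lower[OF _ bdd, of s] \<open>\<not> P s\<close> s by (simp add: c_def B_def)
  have below: "P r" if "0 \<le> r" "r < c" for r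
    using cInf_lower[OF _ bdd, of r] that cT by (force simp: c_def B_def)
  have Pc: "P c"
    using base left[of c] below c0 cT by (cases "c = 0") auto
  have "c < T"
  proof (rule ccontr)
    assume "\<not> c < T"
    with cT have "c = T" by simp
    have "P s" using below[of s] Pc s \<open>c = T\<close> by (cases "s = T") auto
    with \<open>\<not> P s\<close> show False ..
  qed
  from right[OF c0 this Pc] obtain e where e: "e > 0" "\<And>r. c < r \<Longrightarrow> r < c + e \<Longrightarrow> P r"
    by blast
  have "c + e \<le> Inf B"
  proof (rule cInf_greatest[OF ne])
    fix r assume "r \<in> B"
    then show "c + e \<le> r"
      using below[of r] Pc e(2)[of r] by (cases r c rule: linorder_cases) (force simp: B_def)+
  qed
  with e(1) show False by (simp add: c_def)
qed

lemma norm_diff_scaleR_squared: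
  fixes w h :: "'a::real_inner"
  shows "(norm (w - c *\<^sub>R h))\<^sup>2 = (norm w)\<^sup>2 - 2 * c * (h \<bullet> w) + c\<^sup>2 * (norm h)\<^sup>2"
  unfolding power2_norm_eq_inner
  by (simp add: inner_diff_left inner_diff_right inner_commute algebra_simps power2_eq_square)

section \<open>Convex functions with gradient-dependent smoothness\<close>

text \<open>\<open>F\<close> stands for the real part of an extended-real function on its domain
  \<open>X\<close>. Infinite values are invisible here, so \<open>no_escape\<close> records what
  continuity on the closure provides: a segment along which \<open>F\<close> stays bounded cannot
  end outside \<open>X\<close>.\<close>

locale smooth_convex =
  fixes X :: "'a::euclidean_space set" and F :: "'a \<Rightarrow> real" and g :: "'a \<Rightarrow> 'a"
    and l :: "real \<Rightarrow> real"
  assumes open_X: "open X" and convex_X: "convex X"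
    and F_deriv: "x \<in> X \<Longrightarrow> (F has_derivative (\<lambda>h. h \<bullet> g x)) (at x)"
    and g_deriv: "x \<in> X \<Longrightarrow>
      \<exists>H. (g has_derivative H) (at x) \<and> (\<forall>v. norm (H v) \<le> l (norm (g x)) * norm v)"
    and tangent_below: "x \<in> X \<Longrightarrow> y \<in> X \<Longrightarrow> F x + g x \<bullet> (y - x) \<le> F y"
    and no_escape: "0 < T \<Longrightarrow>
      (\<And>s. 0 \<le> s \<Longrightarrow> s < T \<Longrightarrow> x + s *\<^sub>R v \<in> X \<and> F (x + s *\<^sub>R v) \<le> C) \<Longrightarrow> x + T *\<^sub>R v \<in> X"
    and l_mono: "mono_on {0..} l" and l_pos: "0 \<le> s \<Longrightarrow> 0 < l s"
    and l_cont: "continuous_on {0..} l"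
begin

lemma l_le: "0 \<le> s \<Longrightarrow> s \<le> t \<Longrightarrow> l s \<le> l t"
  using l_mono by (auto simp: mono_on_def)

text \<open>The time in which the solution of \<open>p' = l (a + p)\<close> with initial value 0
  reaches \<open>p\<close>. It is a distance that can be travelled from a point of gradient norm
  \<open>a\<close> before the gradient has moved by more than \<open>p\<close>.\<close>

definition q :: "real \<Rightarrow> real \<Rightarrow> real" where
  "q a p = integral {0..p} (\<lambda>w. 1 / l (a + w))"

lemma integrable_inv_l: "0 \<le> a \<Longrightarrow> 0 \<le> p \<Longrightarrow> (\<lambda>w. 1 / l (a + w)) integrable_on {p..r}"
proof (rule integrable_continuous_real)
  assume "0 \<le> a" "0 \<le> p"
  then have "continuous_on {p..r} (\<lambda>w. l (a + w))"
    by (intro continuous_on_compose2[OF l_cont] continuous_intros) auto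
  moreover have "l (a + w) \<noteq> 0" if "w \<in> {p..r}" for w
    using l_pos[of "a + w"] that \<open>0 \<le> a\<close> \<open>0 \<le> p\<close> by simp
  ultimately show "continuous_on {p..r} (\<lambda>w. 1 / l (a + w))"
    by (intro continuous_intros) auto
qed

lemma q_0 [simp]: "q a 0 = 0"
  by (simp add: q_def)

text \<open>Since \<open>l\<close> is non-decreasing, the integrand on \<open>{p..r}\<close> lies
  between its endpoint values. These bounds replace differentiation of \<open>q\<close>.\<close>

lemma q_increment:
  assumes "0 \<le> a" "0 \<le> p" "p \<le> r"
  shows "q a r \<le> q a p + (r - p) / l (a + p)" "q a p + (r - p) / l (a + r) \<le> q a r"
proof -
  let ?f = "\<lambda>w. 1 / l (a + w)"
  have split: "q a r = q a p + integral {p..r} ?f"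
    unfolding q_def using assms by (simp add: Henstock_Kurzweil_Integration.integral_combine integrable_inv_l)
  have "integral {p..r} ?f \<le> integral {p..r} (\<lambda>_. 1 / l (a + p))"
    using assms by (intro integral_le integrable_inv_l)
      (auto intro!: divide_left_mono l_le mult_pos_pos l_pos)
  then show "q a r \<le> q a p + (r - p) / l (a + p)"
    using split assms by simp
  have "integral {p..r} (\<lambda>_. 1 / l (a + r)) \<le> integral {p..r} ?f"
    using assms by (intro integral_le integrable_inv_l)
      (auto intro!: divide_left_mono l_le mult_pos_pos l_pos)
  then show "q a p + (r - p) / l (a + r) \<le> q a r"
    using split assms by simp
qed

lemma q_mono: "0 \<le> a \<Longrightarrow> 0 \<le> p \<Longrightarrow> p \<le> r \<Longrightarrow> q a p \<le> q a r"
  by (smt (verit) q_increment(2) l_pos divide_nonneg_pos)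

text \<open>The integrand is positive, so \<open>q a\<close> is strictly increasing; this turns
  bounds on \<open>q\<close> back into bounds on gradient differences.\<close>

lemma q_le_imp_le: "0 \<le> a \<Longrightarrow> 0 \<le> p \<Longrightarrow> 0 \<le> r \<Longrightarrow> q a p \<le> q a r \<Longrightarrow> p \<le> r"
  by (smt (verit) q_increment(2) l_pos divide_pos_pos)

lemma q_lipschitz:
  assumes "0 \<le> a" "0 \<le> p" "0 \<le> r"
  shows "q a r - q a p \<le> \<bar>r - p\<bar> / l 0"
proof (cases "p \<le> r")
  case True
  have "(r - p) / l (a + p) \<le> (r - p) / l 0"
    using assms True by (intro divide_left_mono l_le mult_pos_pos l_pos) auto
  with q_increment(1)[of a p r] assms True show ?thesis by simp
next
  case False
  then have "q a r - q a p \<le> 0" using q_mono[of a r p] assms by simp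
  also have "0 \<le> \<bar>r - p\<bar> / l 0" using l_pos[of 0] by simp
  finally show ?thesis .
qed

lemma q_continuous: "0 \<le> a \<Longrightarrow> continuous_on {0..} (q a)"
proof (rule lipschitz_on_continuous_on[where L = "1 / l 0"], rule lipschitz_onI)
  fix p r :: real assume "0 \<le> a" "p \<in> {0..}" "r \<in> {0..}"
  then show "dist (q a p) (q a r) \<le> 1 / l 0 * dist p r"
    using q_lipschitz[of a p r] q_lipschitz[of a r p]
    by (auto simp: dist_real_def abs_le_iff abs_minus_commute)
qed (use l_pos[of 0] in simp)

section \<open>Gradients along straight paths\<close>

lemma g_continuous: "x \<in> X \<Longrightarrow> isCont g x"
  using g_deriv has_derivative_continuous by blast

text \<open>The tangent at the moving point, evaluated at \<open>x\<close>, bounds \<open>F\<close>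
  there by means of the gradient. A bounded gradient thus bounds \<open>F\<close>, and
  \<open>no_escape\<close> applies.\<close>

lemma limit_in_X:
  assumes T: "0 < T"
    and inX: "\<And>r. 0 \<le> r \<Longrightarrow> r < T \<Longrightarrow> x + r *\<^sub>R v \<in> X"
    and gb: "\<And>r. 0 \<le> r \<Longrightarrow> r < T \<Longrightarrow> norm (g (x + r *\<^sub>R v) - g x) \<le> M"
  shows "x + T *\<^sub>R v \<in> X"
proof (rule no_escape[OF T], rule conjI)
  have x: "x \<in> X" using inX[of 0] T by simp
  have M: "0 \<le> M" using gb[of 0] T by simp
  fix r assume r: "0 \<le> r" "r < T"
  show rX: "x + r *\<^sub>R v \<in> X" by (rule inX[OF r])
  have "norm (g (x + r *\<^sub>R v)) \<le> norm (g x) + M"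
    using gb[OF r] norm_triangle_sub[of "g (x + r *\<^sub>R v)" "g x"] by simp
  then have *: "g (x + r *\<^sub>R v) \<bullet> v \<le> (norm (g x) + M) * norm v"
    using norm_cauchy_schwarz[of "g (x + r *\<^sub>R v)" v]
      mult_right_mono[of "norm (g (x + r *\<^sub>R v))" "norm (g x) + M" "norm v"] by simp
  have "F (x + r *\<^sub>R v) \<le> F x + r * (g (x + r *\<^sub>R v) \<bullet> v)"
    using tangent_below[OF rX x] by simp
  also have "r * (g (x + r *\<^sub>R v) \<bullet> v) \<le> r * ((norm (g x) + M) * norm v)"
    using * r by (intro mult_left_mono) auto
  also have "\<dots> \<le> T * ((norm (g x) + M) * norm v)"
    using r M by (intro mult_right_mono) auto
  finally show "F (x + r *\<^sub>R v) \<le> F x + T * ((norm (g x) + M) * norm v)" by simp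
qed

text \<open>A real-variable comparison for \<open>p' \<le> l (a + p) \<bar>v\<bar>\<close>, whose maximal solution
  satisfies \<open>q a (p s) = s \<bar>v\<bar>\<close>; the factor \<open>c > 1\<close> absorbs the first-order error terms.\<close>

lemma path_slack:
  assumes x: "x \<in> X" and a: "a = norm (g x)" and M: "0 \<le> M" and c: "1 < c"
    and bound: "c * T * norm v \<le> q a M" and s: "0 \<le> s" "s \<le> T"
  shows "x + s *\<^sub>R v \<in> X \<and> q a (norm (g (x + s *\<^sub>R v) - g x)) \<le> c * s * norm v"
proof (cases "v = 0")
  case True
  with x show ?thesis by simp
next
  case v: False
  define P where
    "P s \<longleftrightarrow> x + s *\<^sub>R v \<in> X \<and> q a (norm (g (x + s *\<^sub>R v) - g x)) \<le> c * s * norm v" for s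
  have a0: "0 \<le> a" by (simp add: a)
  have "P s"
  proof (rule real_induction[of P T, OF _ _ _ s])
    show "P 0" using x by (simp add: P_def)
  next
    fix s assume s: "0 \<le> s" "s < T" "P s"
    let ?y = "x + s *\<^sub>R v"
    let ?p = "norm (g ?y - g x)"
    have y: "?y \<in> X" using s(3) by (simp add: P_def)
    obtain H where H: "(g has_derivative H) (at ?y)"
      and Hn: "\<And>w. norm (H w) \<le> l (norm (g ?y)) * norm w"
      using g_deriv[OF y] by blast
    have lp: "l (norm (g ?y)) > 0" by (simp add: l_pos)
    have "(c - 1) * l (norm (g ?y)) > 0" using c lp by simp
    then obtain d where d: "d > 0"
      and gd: "\<And>z. norm (z - ?y) < d \<Longrightarrow>
        norm (g z - g ?y - H (z - ?y)) \<le> (c - 1) * l (norm (g ?y)) * norm (z - ?y)"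
      using H unfolding has_derivative_at_alt by blast
    obtain d' where d': "d' > 0" and ball: "ball ?y d' \<subseteq> X"
      using open_X y open_contains_ball by blast
    define e where "e = min d d' / norm v"
    have "e > 0" using d d' v by (simp add: e_def)
    moreover have "P r" if r: "s < r" "r < s + e" for r
    proof -
      let ?z = "x + r *\<^sub>R v"
      have zy: "?z - ?y = (r - s) *\<^sub>R v" by (simp add: scaleR_diff_left)
      have nzy: "norm (?z - ?y) = (r - s) * norm v" using r by (simp only: zy) simp
      have "(r - s) * norm v < e * norm v" using r v by simp
      also have "\<dots> = min d d'" using v by (simp add: e_def)
      finally have lt: "norm (?z - ?y) < d" "norm (?z - ?y) < d'"
        by (simp_all only: nzy min_less_iff_conj)
      have zX: "?z \<in> X" using lt(2) ball by (auto simp: dist_norm norm_minus_commute)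
      have "norm (g ?z - g ?y) \<le> norm (g ?z - g ?y - H (?z - ?y)) + norm (H (?z - ?y))"
        using norm_triangle_sub[of "g ?z - g ?y" "H (?z - ?y)"] by linarith
      also have "\<dots> \<le> (c - 1) * l (norm (g ?y)) * norm (?z - ?y)
          + l (norm (g ?y)) * norm (?z - ?y)"
        by (intro add_mono gd lt Hn)
      also have "\<dots> = c * l (norm (g ?y)) * ((r - s) * norm v)"
        unfolding nzy by (simp add: algebra_simps)
      \<comment> \<open>Replacing the gradient norm by \<open>a + ?p\<close> lets
        \<open>q_increment\<close> cancel the factor \<open>l (a + ?p)\<close> below.\<close>
      also have "\<dots> \<le> c * l (a + ?p) * ((r - s) * norm v)"
      proof -
        have "norm (g ?y) \<le> a + ?p"
          unfolding a using norm_triangle_sub[of "g ?y" "g x"] by simp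
        then show ?thesis using c r
          by (intro mult_right_mono mult_left_mono l_le) auto
      qed
      finally have step: "norm (g ?z - g ?y) \<le> c * l (a + ?p) * ((r - s) * norm v)" .
      let ?d = "c * l (a + ?p) * ((r - s) * norm v)"
      have lap: "l (a + ?p) > 0" using a0 by (intro l_pos) simp
      have d0: "0 \<le> ?d" using c r lap by simp
      have "norm (g ?z - g x) \<le> ?p + ?d"
        using norm_triangle_ineq[of "g ?y - g x" "g ?z - g ?y"] step by simp
      then have "q a (norm (g ?z - g x)) \<le> q a (?p + ?d)"
        using a0 by (intro q_mono) auto
      also have "\<dots> \<le> q a ?p + ?d / l (a + ?p)"
        using q_increment(1)[of a ?p "?p + ?d"] a0 d0 by simp
      also have "?d / l (a + ?p) = c * ((r - s) * norm v)"
        using lap by (simp add: field_simps)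
      also have "q a ?p + c * ((r - s) * norm v) \<le> c * r * norm v"
        using s(3) by (simp add: P_def algebra_simps)
      finally show ?thesis using zX by (simp add: P_def)
    qed
    ultimately show "\<exists>e>0. \<forall>r. s < r \<and> r < s + e \<longrightarrow> P r" by blast
  next
    fix s assume s: "0 < s" "s \<le> T" and IH: "\<And>r. 0 \<le> r \<Longrightarrow> r < s \<Longrightarrow> P r"
    \<comment> \<open>The bound on \<open>q\<close> before \<open>s\<close> keeps the gradient
      difference below \<open>M\<close>, so the path is still in the domain at
      \<open>s\<close>.\<close>
    have sX: "x + s *\<^sub>R v \<in> X"
    proof (rule limit_in_X[OF s(1)])
      fix r assume r: "0 \<le> r" "r < s"
      show "x + r *\<^sub>R v \<in> X" using IH[OF r] by (simp add: P_def)
      have "q a (norm (g (x + r *\<^sub>R v) - g x)) \<le> c * r * norm v"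
        using IH[OF r] by (simp add: P_def)
      also have "\<dots> \<le> c * T * norm v"
        using r s c by (intro mult_right_mono mult_left_mono) auto
      also note bound
      finally show "norm (g (x + r *\<^sub>R v) - g x) \<le> M"
        using q_le_imp_le[OF a0 norm_ge_zero M] by blast
    qed
    have "((\<lambda>r. g (x + r *\<^sub>R v)) \<longlongrightarrow> g (x + s *\<^sub>R v)) (at_left s)"
      by (rule isCont_tendsto_compose[OF g_continuous[OF sX]]) (intro tendsto_intros)
    then have "((\<lambda>r. norm (g (x + r *\<^sub>R v) - g x)) \<longlongrightarrow> norm (g (x + s *\<^sub>R v) - g x)) (at_left s)"
      by (intro tendsto_intros)
    then have "((\<lambda>r. q a (norm (g (x + r *\<^sub>R v) - g x))) \<longlongrightarrow> q a (norm (g (x + s *\<^sub>R v) - g x)))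
        (at_left s)"
      by (rule continuous_on_tendsto_compose[OF q_continuous[OF a0]]) auto
    moreover have "((\<lambda>r. c * r * norm v) \<longlongrightarrow> c * s * norm v) (at_left s)"
      by (intro tendsto_intros)
    moreover have "\<forall>\<^sub>F r in at_left s. q a (norm (g (x + r *\<^sub>R v) - g x)) \<le> c * r * norm v"
      using eventually_at_left_real[OF s(1)]
      by eventually_elim (use IH in \<open>auto simp: P_def\<close>)
    ultimately have "q a (norm (g (x + s *\<^sub>R v) - g x)) \<le> c * s * norm v"
      by (intro tendsto_le) auto
    with sX show "P s" by (simp add: P_def)
  qed
  then show ?thesis by (simp add: P_def)
qed

text \<open>The slack factor of \<open>path_slack\<close> may depend on the point:
  \<open>c = T / s\<close> serves for \<open>0 < s < T\<close>. The endpoint follows by continuity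
  of \<open>g\<close>, once \<open>limit_in_X\<close> has placed it in \<open>X\<close>.\<close>

lemma path:
  assumes x: "x \<in> X" and M: "0 \<le> M" and T: "0 \<le> T"
    and bound: "T * norm v \<le> q (norm (g x)) M"
  shows "x + T *\<^sub>R v \<in> X \<and> norm (g (x + T *\<^sub>R v) - g x) \<le> M"
proof (cases "T = 0")
  case True
  with x M show ?thesis by simp
next
  case False
  with T have T: "0 < T" by simp
  have below: "x + s *\<^sub>R v \<in> X \<and> norm (g (x + s *\<^sub>R v) - g x) \<le> M" if s: "0 \<le> s" "s < T" for s
  proof (cases "s = 0")
    case True
    with x M show ?thesis by simp
  next
    case False
    with s have s0: "0 < s" by simp
    define c where "c = T / s"
    have c: "1 < c" "c * s = T" using s0 s by (auto simp: c_def)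
    have "c * s * norm v \<le> q (norm (g x)) M" using bound c by simp
    from path_slack[OF x refl M c(1) this s(1) order_refl] this
    show ?thesis using q_le_imp_le[OF norm_ge_zero norm_ge_zero M] by (meson order_trans)
  qed
  have TX: "x + T *\<^sub>R v \<in> X"
    by (rule limit_in_X[OF T]) (use below in auto)
  have "((\<lambda>r. g (x + r *\<^sub>R v)) \<longlongrightarrow> g (x + T *\<^sub>R v)) (at_left T)"
    by (rule isCont_tendsto_compose[OF g_continuous[OF TX]]) (intro tendsto_intros)
  then have lim: "((\<lambda>r. norm (g (x + r *\<^sub>R v) - g x)) \<longlongrightarrow> norm (g (x + T *\<^sub>R v) - g x)) (at_left T)"
    by (intro tendsto_intros)
  have ev: "\<forall>\<^sub>F r in at_left T. norm (g (x + r *\<^sub>R v) - g x) \<le> M"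
    using eventually_at_left_real[OF T]
    by eventually_elim (use below in auto)
  have "norm (g (x + T *\<^sub>R v) - g x) \<le> M"
    by (rule tendsto_upperbound[OF lim ev]) simp
  with TX show ?thesis ..
qed

section \<open>Cocoercivity with a local constant\<close>

text \<open>Tilting \<open>F\<close> by the linear function with gradient \<open>g y\<close> makes
  \<open>y\<close> a minimizer. Moving from \<open>x\<close> against the tilted gradient for time
  \<open>1 / L\<close> lowers the tilted function by at least \<open>D\<^sup>2 / (2 * L)\<close>,
  yet not below its value at \<open>y\<close>.\<close>

lemma cocoercive:
  assumes x: "x \<in> X" and y: "y \<in> X"
  shows "F y + g y \<bullet> (x - y)
      + (norm (g x - g y))\<^sup>2 / (2 * l (norm (g x) + norm (g x - g y))) \<le> F x"
proof -
  define D where "D = norm (g x - g y)"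
  define L where "L = l (norm (g x) + D)"
  define v where "v = - (g x - g y)"
  have D0: "0 \<le> D" and nv: "norm v = D" by (simp_all add: D_def v_def norm_minus_commute)
  have L: "0 < L" using D0 by (simp add: L_def l_pos)
  have seg: "x + s *\<^sub>R v \<in> X \<and> norm (g (x + s *\<^sub>R v) - g x) \<le> L * s * D"
    if s: "0 \<le> s" "s \<le> 1 / L" for s
  proof (rule path[OF x _ s(1)])
    have Ls: "L * s \<le> 1" "0 \<le> L * s" using s L by (simp_all add: field_simps)
    then show *: "0 \<le> L * s * D" using D0 by simp
    have LsD: "L * s * D \<le> D" using Ls D0 mult_right_mono[of "L * s" 1 D] by simp
    have "s * D = L * s * D / L" using L by simp
    also have "\<dots> \<le> L * s * D / l (norm (g x) + L * s * D)"
      unfolding L_def using LsD * D0 L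
      by (intro divide_left_mono l_le mult_pos_pos l_pos) (auto simp: L_def)
    also have "\<dots> \<le> q (norm (g x)) (L * s * D)"
      using q_increment(2)[of "norm (g x)" 0 "L * s * D"] * by simp
    finally show "s * norm v \<le> q (norm (g x)) (L * s * D)" by (simp add: nv)
  qed
  \<comment> \<open>The tilted function along the path has derivative at most
    \<open>L * D\<^sup>2 * s - D\<^sup>2\<close>; \<open>k\<close> subtracts the integral of this
    bound and is therefore non-increasing.\<close>
  define k where "k s = F (x + s *\<^sub>R v) - s * (v \<bullet> g y) + s * D\<^sup>2 - L * D\<^sup>2 * s\<^sup>2 / 2" for s
  have "k (1 / L) \<le> k 0"
  proof (rule DERIV_nonpos_imp_nonincreasing[where f = k and a = 0 and b = "1 / L"])
    show "0 \<le> 1 / L" using L by simp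
    fix s assume s: "0 \<le> s" "s \<le> 1 / L"
    let ?z = "x + s *\<^sub>R v"
    have z: "?z \<in> X" "norm (g ?z - g x) \<le> L * s * D" using seg[OF s] by auto
    have "((\<lambda>s. F (x + s *\<^sub>R v)) has_derivative (\<lambda>h. (h *\<^sub>R v) \<bullet> g ?z)) (at s)"
      by (rule has_derivative_compose[of "\<lambda>s. x + s *\<^sub>R v" "\<lambda>h. h *\<^sub>R v", OF _ F_deriv[OF z(1)]])
        (auto intro!: derivative_eq_intros)
    then have "((\<lambda>s. F (x + s *\<^sub>R v)) has_real_derivative (v \<bullet> g ?z)) (at s)"
      by (rule has_derivative_imp_has_field_derivative) simp
    then have "(k has_real_derivative (v \<bullet> g ?z - v \<bullet> g y + D\<^sup>2 - L * D\<^sup>2 * s)) (at s)"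
      unfolding k_def by (auto intro!: derivative_eq_intros)
    moreover have "v \<bullet> g ?z - v \<bullet> g y + D\<^sup>2 - L * D\<^sup>2 * s \<le> 0"
    proof -
      have "v \<bullet> g ?z - v \<bullet> g y = v \<bullet> (g ?z - g x) + v \<bullet> (g x - g y)"
        by (simp add: inner_diff_right)
      also have "v \<bullet> (g x - g y) = - D\<^sup>2"
        by (simp add: v_def D_def power2_norm_eq_inner inner_diff_left inner_diff_right)
      finally have "v \<bullet> g ?z - v \<bullet> g y + D\<^sup>2 = v \<bullet> (g ?z - g x)" by simp
      also have "\<dots> \<le> norm v * norm (g ?z - g x)" by (rule norm_cauchy_schwarz)
      also have "\<dots> \<le> D * (L * s * D)"
        unfolding nv using z(2) D0 by (intro mult_left_mono)
      finally show ?thesis by (simp add: power2_eq_square algebra_simps)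
    qed
    ultimately show "\<exists>d. (k has_real_derivative d) (at s) \<and> d \<le> 0" by blast
  qed
  moreover have "k (1 / L) = F (x + (1 / L) *\<^sub>R v) - (1 / L) * (v \<bullet> g y) + D\<^sup>2 / (2 * L)"
    using L by (simp add: k_def field_simps power2_eq_square)
  moreover have "F y + g y \<bullet> (x + (1 / L) *\<^sub>R v - y) \<le> F (x + (1 / L) *\<^sub>R v)"
    using seg[of "1 / L"] L by (intro tangent_below y) auto
  ultimately have "F y + g y \<bullet> (x - y) + D\<^sup>2 / (2 * L) \<le> F x"
    by (simp add: k_def inner_simps inner_commute)
  then show ?thesis by (simp add: D_def L_def)
qed

end

section \<open>Gradient descent and the distance to a minimizer\<close>

locale smooth_convex_min = smooth_convex X F g l
  for X :: "'a::euclidean_space set" and F g l +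
  fixes xs :: 'a
  assumes xs: "xs \<in> X" and F_min: "x \<in> X \<Longrightarrow> F xs \<le> F x"
begin

lemma g_xs: "g xs = 0"
proof -
  have "(\<lambda>h. h \<bullet> g xs) = (\<lambda>h. 0)"
    using differential_zero_maxmin[OF xs open_X F_deriv[OF xs]] F_min by blast
  then show ?thesis by (metis inner_eq_zero_iff)
qed

text \<open>For \<open>a = norm (g x) > 0\<close> the step has length \<open>q a a\<close>, so
  \<open>path\<close> keeps it in \<open>X\<close>. Cocoercivity against \<open>xs\<close> together
  with \<open>\<eta> \<le> 1 / l a\<close> makes the quadratic term of the expanded squared distance
  no larger than the linear one.\<close>

lemma gd_step:
  assumes x: "x \<in> X"
    and \<eta>: "\<eta> = integral {0..1} (\<lambda>v. 1 / l (norm (g x) + norm (g x) * v))"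
  shows "x - \<eta> *\<^sub>R g x \<in> X \<and> norm (x - \<eta> *\<^sub>R g x - xs) \<le> norm (x - xs)"
proof (cases "g x = 0")
  case True
  with x show ?thesis by simp
next
  case False
  define a where "a = norm (g x)"
  have a: "0 < a" using False by (simp add: a_def)
  have "((\<lambda>w. 1 / l (a + w)) has_integral q a a) {0..a}"
    unfolding q_def using a by (intro integrable_integral integrable_inv_l) auto
  \<comment> \<open>Substituting \<open>w = a * v\<close> turns the step size into
    \<open>q a a / a\<close>.\<close>
  from has_integral_stretch_real[OF this, of a]
  have int: "((\<lambda>v. 1 / l (a + a * v)) has_integral q a a / a) {0..1}"
    using a by (simp add: image_divide_atLeastAtMost)
  then have \<eta>q: "\<eta> = q a a / a"
    unfolding \<eta> a_def[symmetric] by (rule integral_unique)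
  have "x + \<eta> *\<^sub>R (- g x) \<in> X \<and> norm (g (x + \<eta> *\<^sub>R (- g x)) - g x) \<le> a"
  proof (rule path[OF x])
    show "\<eta> * norm (- g x) \<le> q (norm (g x)) a" using a by (simp add: \<eta>q flip: a_def)
    show "0 \<le> \<eta>" using q_mono[of a 0 a] a by (simp add: \<eta>q)
  qed (use a in simp)
  moreover have "\<eta> * a\<^sup>2 \<le> 2 * (g x \<bullet> (x - xs))"
  proof -
    have "q a a \<le> a / l a" using q_increment(1)[of a 0 a] a by simp
    then have "\<eta> * a\<^sup>2 \<le> a\<^sup>2 / l a"
      using a mult_right_mono[of "q a a" "a / l a" a] by (simp add: \<eta>q power2_eq_square)
    moreover have "F x + g x \<bullet> (xs - x) + a\<^sup>2 / (2 * l a) \<le> F x"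
      using cocoercive[OF xs x] F_min[OF x] by (simp add: g_xs a_def)
    ultimately show ?thesis by (simp add: inner_diff_right)
  qed
  then have "\<eta> * (\<eta> * a\<^sup>2) \<le> \<eta> * (2 * (g x \<bullet> (x - xs)))"
    using q_mono[of a 0 a] a by (intro mult_left_mono) (simp_all add: \<eta>q)
  then have "(norm (x - xs - \<eta> *\<^sub>R g x))\<^sup>2 \<le> (norm (x - xs))\<^sup>2"
    unfolding norm_diff_scaleR_squared by (simp add: a_def algebra_simps power2_eq_square)
  then have "(norm (x - \<eta> *\<^sub>R g x - xs))\<^sup>2 \<le> (norm (x - xs))\<^sup>2"
    by (simp add: algebra_simps)
  then have "norm (x - \<eta> *\<^sub>R g x - xs) \<le> norm (x - xs)"
    by (rule power2_le_imp_le) simp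
  ultimately show ?thesis by simp
qed

end

section \<open>Energy estimates for the accelerated phase\<close>

text \<open>The threshold \<open>t\<close> stands for \<open>2 * sqrt (\<delta> * l 0)\<close>: by monotonicity of \<open>\<psi>\<close> and
  \<open>\<psi> t \<ge> \<delta>\<close>, a gap below \<open>\<delta>\<close> forces gradients below \<open>t\<close>, where \<open>f\<close> behaves like a
  \<open>2 * l 0\<close>-smooth function.\<close>

locale accelerated = smooth_convex_min X F g l xs
  for X :: "'a::euclidean_space set" and F g l xs +
  fixes \<delta> t \<gamma> :: real
  assumes psi: "strict_mono_on {0..} (\<lambda>x. x\<^sup>2 / (2 * l (4 * x)))"
    and t: "0 \<le> t" "l (4 * t) \<le> 2 * l 0" "\<delta> \<le> t\<^sup>2 / (2 * l (4 * t))"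
    and \<gamma>: "\<gamma> = 1 / (2 * l 0)"
begin

lemma \<gamma>_pos: "0 < \<gamma>"
  using l_pos[of 0] by (simp add: \<gamma>)

lemma inverse_l_ge: "0 \<le> s \<Longrightarrow> s \<le> 4 * t \<Longrightarrow> \<gamma> \<le> 1 / l s"
  unfolding \<gamma> using l_le[of s "4 * t"] t l_pos[of s] l_pos[of 0]
  by (intro divide_left_mono) auto

lemma grad_small:
  assumes x: "x \<in> X" and gap: "F x - F xs < \<delta>"
  shows "norm (g x) < t"
proof (rule ccontr)
  define a where "a = norm (g x)"
  assume "\<not> norm (g x) < t"
  then have "t\<^sup>2 / (2 * l (4 * t)) \<le> a\<^sup>2 / (2 * l (4 * a))"
    using strict_mono_on_leD[OF psi, of t a] t by (simp add: a_def)
  \<comment> \<open>Cocoercivity against \<open>xs\<close> involves \<open>l (a + a)\<close>, which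
    is at most the \<open>l (4 * a)\<close> in \<open>psi\<close>.\<close>
  also have "\<dots> \<le> a\<^sup>2 / (2 * l (a + a))"
    by (intro divide_left_mono mult_left_mono l_le mult_pos_pos l_pos) (auto simp: a_def l_pos)
  also have "\<dots> \<le> F x - F xs"
    using cocoercive[OF x xs] by (simp add: g_xs a_def)
  finally show False using t gap by simp
qed

lemma cocoercive_small:
  assumes "x \<in> X" "y \<in> X" "norm (g x) + norm (g x - g y) \<le> 4 * t"
  shows "F y + g y \<bullet> (x - y) + \<gamma> / 2 * (norm (g x - g y))\<^sup>2 \<le> F x"
proof -
  let ?s = "norm (g x) + norm (g x - g y)"
  have "\<gamma> * ((norm (g x - g y))\<^sup>2 / 2) \<le> 1 / l ?s * ((norm (g x - g y))\<^sup>2 / 2)"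
    using assms by (intro mult_right_mono inverse_l_ge) auto
  then show ?thesis using cocoercive[OF assms(1,2)] by (simp add: field_simps)
qed

text \<open>\<open>path\<close> with \<open>M = norm (g y)\<close> keeps the step in
  \<open>X\<close>. Cocoercivity of \<open>y\<close> against the new point gives the decrease, since
  with step size \<open>\<gamma>\<close> the mixed gradient terms cancel.\<close>

lemma gradient_step:
  assumes y: "y \<in> X" and gy: "norm (g y) \<le> t"
  shows "y - \<gamma> *\<^sub>R g y \<in> X \<and> F (y - \<gamma> *\<^sub>R g y) \<le> F y"
proof -
  let ?z = "y + \<gamma> *\<^sub>R (- g y)" and ?n = "norm (g y)"
  have z: "?z \<in> X \<and> norm (g ?z - g y) \<le> ?n"
  proof (rule path[OF y])
    have "\<gamma> * ?n \<le> 1 / l (?n + ?n) * ?n"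
      using gy t(1) by (intro mult_right_mono inverse_l_ge) auto
    also have "\<dots> \<le> q ?n ?n" using q_increment(2)[of ?n 0 ?n] by simp
    finally show "\<gamma> * norm (- g y) \<le> q ?n ?n" by simp
  qed (use \<gamma>_pos in auto)
  have "F ?z + g ?z \<bullet> (y - ?z) + \<gamma> / 2 * (norm (g y - g ?z))\<^sup>2 \<le> F y"
  proof (rule cocoercive_small[OF y])
    show "norm (g y) + norm (g y - g ?z) \<le> 4 * t"
      using z gy t(1) norm_minus_commute[of "g y" "g ?z"] by linarith
  qed (use z in simp)
  moreover have "g ?z \<bullet> (y - ?z) + \<gamma> / 2 * (norm (g y - g ?z))\<^sup>2
      = \<gamma> / 2 * ((norm (g y))\<^sup>2 + (norm (g ?z))\<^sup>2)"
    by (simp add: power2_norm_eq_inner inner_simps inner_commute algebra_simps)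
  moreover have "0 \<le> \<gamma> / 2 * ((norm (g y))\<^sup>2 + (norm (g ?z))\<^sup>2)"
    using \<gamma>_pos by simp
  ultimately show ?thesis using z by simp
qed

text \<open>A Lyapunov function. The subtracted term is part of the decrease that a gradient step
  from \<open>y\<close> brings when \<open>norm (g y) \<le> t\<close>.\<close>

definition energy :: "'a \<Rightarrow> 'a \<Rightarrow> real \<Rightarrow> real" where
  "energy y u \<Gamma> = F y - F xs - \<gamma> / 2 * (norm (g y))\<^sup>2 + \<Gamma> / 2 * (norm (u - xs))\<^sup>2"

text \<open>Add cocoercivity of \<open>y\<close> against \<open>y'\<close> to \<open>\<beta>\<close>
  times that of \<open>xs\<close> against \<open>y'\<close>. By \<open>step\<close> the linear terms
  become one in \<open>u - xs\<close> and a product \<open>g y' \<bullet> g y\<close>, which cancels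
  against the expanded square of \<open>g y - g y'\<close>.\<close>

lemma estimate:
  assumes y: "y \<in> X" "norm (g y) \<le> t" and y': "y' \<in> X" "norm (g y') \<le> t"
    and \<beta>: "0 \<le> \<beta>" and step: "(1 + \<beta>) *\<^sub>R y' = y + \<beta> *\<^sub>R u - \<gamma> *\<^sub>R g y"
  shows "(1 + \<beta>) * (F y' - F xs) \<le> F y - F xs - \<gamma> / 2 * (norm (g y))\<^sup>2
    + \<beta> * (g y' \<bullet> (u - xs)) - (1 + \<beta>) * \<gamma> / 2 * (norm (g y'))\<^sup>2"
proof -
  \<comment> \<open>Hence \<open>norm (g y) + norm (g y - g y')\<close> is at most
    \<open>3 * t\<close>, within the range of \<open>cocoercive_small\<close>.\<close>
  have "norm (g y - g y') \<le> norm (g y) + norm (g y')" by (rule norm_triangle_ineq4)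
  then have 1: "F y' + g y' \<bullet> (y - y') + \<gamma> / 2 * (norm (g y - g y'))\<^sup>2 \<le> F y"
    using y y' t(1) by (intro cocoercive_small) auto
  have "F y' + g y' \<bullet> (xs - y') + \<gamma> / 2 * (norm (g xs - g y'))\<^sup>2 \<le> F xs"
    using xs y' t(1) by (intro cocoercive_small) (auto simp: g_xs)
  then have "\<beta> * (F y' + g y' \<bullet> (xs - y') + \<gamma> / 2 * (norm (g y'))\<^sup>2) \<le> \<beta> * F xs"
    using \<beta> by (intro mult_left_mono) (auto simp: g_xs)
  moreover have "g y' \<bullet> (y - y') + \<beta> * (g y' \<bullet> (xs - y'))
      = \<beta> * (g y' \<bullet> (xs - u)) + \<gamma> * (g y' \<bullet> g y)"
  proof -
    have "g y' \<bullet> ((1 + \<beta>) *\<^sub>R y') = g y' \<bullet> (y + \<beta> *\<^sub>R u - \<gamma> *\<^sub>R g y)"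
      by (simp only: step)
    then show ?thesis by (simp add: inner_simps algebra_simps)
  qed
  moreover have "\<gamma> / 2 * (norm (g y - g y'))\<^sup>2
      = \<gamma> / 2 * (norm (g y))\<^sup>2 + \<gamma> / 2 * (norm (g y'))\<^sup>2 - \<gamma> * (g y' \<bullet> g y)"
    using arg_cong[OF norm_diff_scaleR_squared[of "g y" 1 "g y'"], of "(*) (\<gamma> / 2)"]
    by (simp add: algebra_simps)
  ultimately show ?thesis using 1
    by (simp add: inner_diff_right algebra_simps add_divide_distrib)
qed

text \<open>Young's inequality splits the inner product of \<open>estimate\<close> into the distance
  term of the energy and a gradient term that \<open>estimate\<close> subtracts. Allowing every
  \<open>\<beta>\<close> with \<open>\<beta>\<^sup>2 \<le> \<gamma> * \<Gamma>\<close> covers the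
  intermediate points of a continuity argument.\<close>

lemma gap_le_energy:
  assumes y: "y \<in> X" "norm (g y) \<le> t" and y': "y' \<in> X" "norm (g y') \<le> t"
    and \<beta>: "0 \<le> \<beta>" "\<beta>\<^sup>2 \<le> \<gamma> * \<Gamma>" and \<Gamma>: "0 < \<Gamma>"
    and step: "(1 + \<beta>) *\<^sub>R y' = y + \<beta> *\<^sub>R u - \<gamma> *\<^sub>R g y"
  shows "(1 + \<beta>) * (F y' - F xs) \<le> energy y u \<Gamma>"
proof -
  let ?g = "g y'" and ?w = "u - xs"
  have "0 \<le> (norm (\<Gamma> *\<^sub>R ?w - \<beta> *\<^sub>R ?g))\<^sup>2" by simp
  also have "\<dots> = \<Gamma>\<^sup>2 * (norm ?w)\<^sup>2 + \<beta>\<^sup>2 * (norm ?g)\<^sup>2 - 2 * \<Gamma> * \<beta> * (?g \<bullet> ?w)"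
    unfolding norm_diff_scaleR_squared by (simp add: power_mult_distrib)
  also have "\<beta>\<^sup>2 * (norm ?g)\<^sup>2 \<le> \<gamma> * \<Gamma> * (norm ?g)\<^sup>2"
    using \<beta> by (intro mult_right_mono) auto
  finally have "0 \<le> \<Gamma> * (\<Gamma> * (norm ?w)\<^sup>2 + \<gamma> * (norm ?g)\<^sup>2 - 2 * \<beta> * (?g \<bullet> ?w))"
    by (simp add: algebra_simps power2_eq_square)
  then have "\<beta> * (?g \<bullet> ?w) \<le> \<Gamma> / 2 * (norm ?w)\<^sup>2 + \<gamma> / 2 * (norm ?g)\<^sup>2"
    using \<Gamma> by (simp add: zero_le_mult_iff)
  moreover have "\<gamma> / 2 * (norm ?g)\<^sup>2 \<le> (1 + \<beta>) * \<gamma> / 2 * (norm ?g)\<^sup>2"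
    using \<beta> \<gamma>_pos by (intro mult_right_mono) auto
  ultimately show ?thesis
    using estimate[OF y y' \<beta>(1) step] by (simp add: energy_def)
qed

text \<open>The gradient bound at \<open>y'\<close> cannot be read off from a convex combination of function
  values, since \<open>F u\<close> may be infinite. Instead, move \<open>y'\<close> continuously from the gradient step:
  whenever the gradient norm is at most \<open>t\<close>, the gap is below \<open>\<delta>\<close>, so the norm never equals \<open>t\<close>.\<close>

lemma next_point:
  assumes y: "y \<in> X" "F y - F xs < \<delta>" and u: "u \<in> closure X"
    and \<alpha>: "0 \<le> \<alpha>" "\<alpha>\<^sup>2 \<le> \<gamma> * \<Gamma>" and \<Gamma>: "0 < \<Gamma>" and E: "energy y u \<Gamma> \<le> \<delta>"
    and step: "(1 + \<alpha>) *\<^sub>R y' = y + \<alpha> *\<^sub>R u - \<gamma> *\<^sub>R g y"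
  shows "y' \<in> X \<and> norm (g y') < t"
proof -
  have gy: "norm (g y) \<le> t" using grad_small[OF y] by simp
  define z where "z = y - \<gamma> *\<^sub>R g y"
  have z: "z \<in> X" "F z \<le> F y" using gradient_step[OF y(1) gy] by (auto simp: z_def)
  have \<delta>: "0 < \<delta>" using y F_min[OF y(1)] by simp
  \<comment> \<open>\<open>Y \<beta>\<close> is the accelerated point with \<open>\<beta>\<close> in
    place of \<open>\<alpha>\<close>: it starts at the gradient step \<open>z\<close> and ends at
    \<open>y'\<close>.\<close>
  define Y where "Y \<beta> = (1 / (1 + \<beta>)) *\<^sub>R (z + \<beta> *\<^sub>R u)" for \<beta>
  \<comment> \<open>A convex combination of \<open>z\<close> in the open set \<open>X\<close> and
    \<open>u\<close> in its closure, with positive weight on \<open>z\<close>, stays in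
    \<open>X\<close>.\<close>
  have YX: "Y \<beta> \<in> X" if "0 \<le> \<beta>" for \<beta>
  proof -
    have "u - (1 / (1 + \<beta>)) *\<^sub>R (u - z) \<in> interior X"
      by (rule mem_interior_closure_convex_shrink[OF convex_X _ u])
        (use that z open_X in \<open>auto simp: interior_open\<close>)
    moreover have "u - (1 / (1 + \<beta>)) *\<^sub>R (u - z) = Y \<beta>"
    proof -
      have "1 - 1 / (1 + \<beta>) = \<beta> / (1 + \<beta>)" using that by (simp add: field_simps)
      then have "u - (1 / (1 + \<beta>)) *\<^sub>R u = (\<beta> / (1 + \<beta>)) *\<^sub>R u"
        by (metis scaleR_left_diff_distrib scaleR_one)
      then show ?thesis by (simp add: Y_def algebra_simps)
    qed
    ultimately show ?thesis using interior_subset by auto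
  qed
  have strict: "norm (g (Y \<beta>)) \<noteq> t" if \<beta>: "0 \<le> \<beta>" "\<beta> \<le> \<alpha>" for \<beta>
  proof
    assume eq: "norm (g (Y \<beta>)) = t"
    \<comment> \<open>Strictness comes from the gap at \<open>y\<close> if
      \<open>\<beta> = 0\<close>, and from the factor \<open>1 + \<beta>\<close> otherwise.\<close>
    have "F (Y \<beta>) - F xs < \<delta>"
    proof (cases "\<beta> = 0")
      case True
      then show ?thesis using z y by (simp add: Y_def)
    next
      case False
      have "(1 + \<beta>) * (F (Y \<beta>) - F xs) \<le> energy y u \<Gamma>"
      proof (rule gap_le_energy[OF y(1) gy YX[OF \<beta>(1)] _ \<beta>(1) _ \<Gamma>])
        show "\<beta>\<^sup>2 \<le> \<gamma> * \<Gamma>" using power_mono[OF \<beta>(2,1), of 2] \<alpha>(2) by simp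
        show "(1 + \<beta>) *\<^sub>R Y \<beta> = y + \<beta> *\<^sub>R u - \<gamma> *\<^sub>R g y"
          using \<beta> by (simp add: Y_def z_def)
      qed (use eq in simp)
      also note E
      also have "\<delta> < (1 + \<beta>) * \<delta>" using False \<beta> \<delta> by simp
      finally show ?thesis using \<beta> by simp
    qed
    from grad_small[OF YX[OF \<beta>(1)] this] eq show False by simp
  qed
  have "continuous_on {0..\<alpha>} (\<lambda>\<beta>. norm (g (Y \<beta>)))"
  proof (rule continuous_on_norm, rule continuous_on_compose2[of X g])
    show "continuous_on X g" using g_continuous by (simp add: continuous_at_imp_continuous_on)
    show "continuous_on {0..\<alpha>} Y" unfolding Y_def by (intro continuous_intros) auto
  qed (use YX in auto)
  then have "\<not> t \<le> norm (g (Y \<alpha>))"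
    using IVT'[of "\<lambda>\<beta>. norm (g (Y \<beta>))" 0 t \<alpha>] strict \<alpha> grad_small[OF z(1)] z y
    by (force simp: Y_def)
  moreover have "y' = Y \<alpha>"
  proof -
    have "(1 + \<alpha>) *\<^sub>R y' = (1 + \<alpha>) *\<^sub>R Y \<alpha>" using \<alpha> by (simp add: Y_def z_def step)
    then show ?thesis using \<alpha> by simp
  qed
  ultimately show ?thesis using YX[OF \<alpha>(1)] by simp
qed

text \<open>Adding \<open>estimate\<close> to the expanded squared distance of \<open>u'\<close>
  cancels the inner products and leaves gradient terms of the right sign. The energy thus shrinks at
  least as fast as \<open>\<Gamma>\<close>, so the bound \<open>C * \<Gamma>\<close> is passed
  on.\<close>

lemma accelerated_step:
  assumes y: "y \<in> X" "F y - F xs < \<delta>" and u: "u \<in> closure X"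
    and \<alpha>: "\<alpha> = sqrt (\<gamma> * \<Gamma>)" and \<Gamma>: "0 < \<Gamma>"
    and C: "0 < C" "C * \<Gamma> \<le> \<delta>" and E: "energy y u \<Gamma> \<le> C * \<Gamma>"
    and y': "y' = (1 / (1 + \<alpha>)) *\<^sub>R y + (\<alpha> / (1 + \<alpha>)) *\<^sub>R u - (\<gamma> / (1 + \<alpha>)) *\<^sub>R g y"
    and u': "u' = closest_point (closure X) (u - (\<alpha> / \<Gamma>) *\<^sub>R g y')"
    and \<Gamma>': "\<Gamma>' = \<Gamma> / (1 + \<alpha>)"
  shows "y' \<in> X" "F y' - F xs < \<delta>" "u' \<in> closure X" "0 < \<Gamma>'" "C * \<Gamma>' \<le> \<delta>"
    "energy y' u' \<Gamma>' \<le> C * \<Gamma>'" "F y' - F xs \<le> C * \<Gamma>'"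
proof -
  have \<alpha>0: "0 < \<alpha>" and \<alpha>2: "\<alpha>\<^sup>2 = \<gamma> * \<Gamma>" using \<alpha> \<gamma>_pos \<Gamma> by auto
  have gy: "norm (g y) \<le> t" using grad_small[OF y] by simp
  have "(1 + \<alpha>) * (1 / (1 + \<alpha>)) = 1" "(1 + \<alpha>) * (\<alpha> / (1 + \<alpha>)) = \<alpha>"
    "(1 + \<alpha>) * (\<gamma> / (1 + \<alpha>)) = \<gamma>"
    using \<alpha>0 by simp_all
  then have step: "(1 + \<alpha>) *\<^sub>R y' = y + \<alpha> *\<^sub>R u - \<gamma> *\<^sub>R g y"
    unfolding y' by (simp only: scaleR_right_distrib scaleR_right_diff_distrib scaleR_scaleR scaleR_one)
  have E\<delta>: "energy y u \<Gamma> \<le> \<delta>" using E C by simp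
  have np: "y' \<in> X" "norm (g y') < t"
    using next_point[OF y u _ _ \<Gamma> E\<delta> step] \<alpha>0 \<alpha>2 by auto
  then show "y' \<in> X" by simp
  show \<Gamma>'0: "0 < \<Gamma>'" using \<Gamma> \<alpha>0 by (simp add: \<Gamma>')
  have \<Gamma>eq: "\<Gamma> = (1 + \<alpha>) * \<Gamma>'" using \<alpha>0 by (simp add: \<Gamma>')
  have lt: "C * \<Gamma>' < C * \<Gamma>" using C \<Gamma>'0 \<alpha>0 unfolding \<Gamma>eq by simp
  then show "C * \<Gamma>' \<le> \<delta>" using C(2) by linarith
  have "(1 + \<alpha>) * (F y' - F xs) \<le> energy y u \<Gamma>"
    using np \<alpha>0 \<alpha>2 by (intro gap_le_energy[OF y(1) gy _ _ _ _ \<Gamma> step]) auto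
  also have "\<dots> \<le> (1 + \<alpha>) * (C * \<Gamma>')" using E unfolding \<Gamma>eq by (simp add: algebra_simps)
  finally show gap: "F y' - F xs \<le> C * \<Gamma>'" using \<alpha>0 by simp
  then show "F y' - F xs < \<delta>" using lt C(2) by linarith
  have ne: "closure X \<noteq> {}" using xs by auto
  show "u' \<in> closure X" unfolding u' by (rule closest_point_in_set) (use ne in auto)
  \<comment> \<open>Projection onto a closed convex set is nonexpansive and fixes
    \<open>xs\<close>.\<close>
  have "norm (u' - xs) \<le> norm (u - (\<alpha> / \<Gamma>) *\<^sub>R g y' - xs)"
    using closest_point_lipschitz[of "closure X" "u - (\<alpha> / \<Gamma>) *\<^sub>R g y'" xs] convex_X ne xs
    by (simp add: u' dist_norm closest_point_self closure_subset[THEN subsetD] convex_closure)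
  then have "(norm (u' - xs))\<^sup>2 \<le> (norm (u - xs - (\<alpha> / \<Gamma>) *\<^sub>R g y'))\<^sup>2"
    by (simp add: cancel_ab_semigroup_add_class.diff_right_commute[of u _ xs])
  also have "\<dots> = (norm (u - xs))\<^sup>2 - 2 * (\<alpha> / \<Gamma>) * (g y' \<bullet> (u - xs)) + (\<alpha> / \<Gamma>)\<^sup>2 * (norm (g y'))\<^sup>2"
    by (rule norm_diff_scaleR_squared)
  finally have "\<Gamma> / 2 * (norm (u' - xs))\<^sup>2 \<le> \<Gamma> / 2 * ((norm (u - xs))\<^sup>2
      - 2 * (\<alpha> / \<Gamma>) * (g y' \<bullet> (u - xs)) + (\<alpha> / \<Gamma>)\<^sup>2 * (norm (g y'))\<^sup>2)"
    using \<Gamma> by (intro mult_left_mono) auto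
  also have "\<dots> = \<Gamma> / 2 * (norm (u - xs))\<^sup>2 - \<alpha> * (g y' \<bullet> (u - xs)) + \<alpha>\<^sup>2 / (2 * \<Gamma>) * (norm (g y'))\<^sup>2"
    using \<Gamma> by (simp add: field_simps power2_eq_square)
  \<comment> \<open>The choice of \<open>\<alpha>\<close> matches the quadratic term with the
    gradient terms of \<open>estimate\<close>.\<close>
  also have "\<alpha>\<^sup>2 / (2 * \<Gamma>) = \<gamma> / 2" using \<Gamma> by (simp add: \<alpha>2)
  finally have "(1 + \<alpha>) * (\<Gamma>' / 2 * (norm (u' - xs))\<^sup>2)
      \<le> \<Gamma> / 2 * (norm (u - xs))\<^sup>2 - \<alpha> * (g y' \<bullet> (u - xs)) + \<gamma> / 2 * (norm (g y'))\<^sup>2"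
    unfolding \<Gamma>eq by (simp add: algebra_simps)
  moreover have "(1 + \<alpha>) * (F y' - F xs) \<le> F y - F xs - \<gamma> / 2 * (norm (g y))\<^sup>2
    + \<alpha> * (g y' \<bullet> (u - xs)) - (1 + \<alpha>) * (\<gamma> / 2 * (norm (g y'))\<^sup>2)"
    using estimate[OF y(1) gy np(1) less_imp_le[OF np(2)] less_imp_le[OF \<alpha>0] step] by simp
  moreover have "\<gamma> / 2 * (norm (g y'))\<^sup>2 \<le> (1 + \<alpha>) * (\<gamma> / 2 * (norm (g y'))\<^sup>2)"
    using \<alpha>0 \<gamma>_pos by (simp add: algebra_simps)
  moreover have "0 \<le> \<gamma> / 2 * (norm (g y'))\<^sup>2" using \<gamma>_pos by simp
  moreover have "(1 + \<alpha>) * energy y' u' \<Gamma>' = (1 + \<alpha>) * (F y' - F xs)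
      - (1 + \<alpha>) * (\<gamma> / 2 * (norm (g y'))\<^sup>2) + (1 + \<alpha>) * (\<Gamma>' / 2 * (norm (u' - xs))\<^sup>2)"
    unfolding energy_def by (simp only: distrib_left right_diff_distrib)
  ultimately have "(1 + \<alpha>) * energy y' u' \<Gamma>' \<le> energy y u \<Gamma>"
    using energy_def[of y u \<Gamma>] by linarith
  also have "\<dots> \<le> (1 + \<alpha>) * (C * \<Gamma>')" using E unfolding \<Gamma>eq by (simp add: algebra_simps)
  finally show "energy y' u' \<Gamma>' \<le> C * \<Gamma>'" using \<alpha>0 by simp
qed

end

section \<open>Decay of the step sizes\<close>

text \<open>While \<open>\<alpha>\<close> exceeds 2, a step divides it by at least
  \<open>3 / 2\<close>; afterwards a step adds at least \<open>4 / 11\<close> to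
  \<open>1 / \<alpha>\<close>. The \<open>max\<close> term pays for the first regime and leaves
  \<open>A\<close> steps for the second.\<close>

lemma alpha_decay:
  fixes \<alpha> :: "nat \<Rightarrow> real"
  assumes pos: "0 < \<alpha> 0" and rec: "\<And>k. \<alpha> (Suc k) = \<alpha> k / sqrt (1 + \<alpha> k)"
    and A: "0 \<le> A"
    and N: "A + max (1 + 1 / 2 * log (3 / 2) ((\<alpha> 0)\<^sup>2 / 4)) 0 \<le> real N"
  shows "4 / 11 * A \<le> 1 / \<alpha> N"
proof -
  have \<alpha>_pos: "0 < \<alpha> k" for k
    by (induction k) (auto simp: pos rec)
  have \<alpha>_dec: "\<alpha> (Suc k) \<le> \<alpha> k" for k
    using \<alpha>_pos[of k] by (simp add: rec divide_le_eq)
  have geometric: "\<alpha> k \<le> max 2 (\<alpha> 0 * (2 / 3) ^ k)" for k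
  proof (induction k)
    case (Suc k)
    show ?case
    proof (cases "\<alpha> k \<le> 2")
      case True
      then show ?thesis using \<alpha>_dec[of k] by simp
    next
      case False
      then have "3 / 2 \<le> sqrt (1 + \<alpha> k)"
        by (intro real_le_rsqrt) (simp add: power2_eq_square)
      then have "\<alpha> (Suc k) \<le> \<alpha> k / (3 / 2)"
        unfolding rec using \<alpha>_pos[of k] by (intro divide_left_mono) auto
      also have "\<dots> \<le> \<alpha> 0 * (2 / 3) ^ Suc k" using Suc False by simp
      finally show ?thesis by simp
    qed
  qed simp
  have harmonic: "4 / 11 * real m \<le> 1 / \<alpha> (k + m)" if "\<alpha> k \<le> 2" for k m
  proof -
    have "\<alpha> (k + m) \<le> 2 \<and> 4 / 11 * real m \<le> 1 / \<alpha> (k + m)"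
    proof (induction m)
      case 0
      then show ?case using that \<alpha>_pos[of k] by simp
    next
      case (Suc m)
      let ?a = "\<alpha> (k + m)"
      have a: "0 < ?a" "?a \<le> 2" using \<alpha>_pos Suc by auto
      \<comment> \<open>By concavity of the square root only \<open>?a = 2\<close> is critical;
        \<open>4 / 11\<close> is a rational just below \<open>(sqrt 3 - 1) / 2\<close>.\<close>
      have "1 + 4 / 11 * ?a \<le> sqrt (1 + ?a)"
      proof (rule real_le_rsqrt)
        have "?a * ?a \<le> 2 * ?a" using a by (intro mult_right_mono) auto
        then show "(1 + 4 / 11 * ?a)\<^sup>2 \<le> 1 + ?a"
          using a by (simp add: power2_eq_square field_simps)
      qed
      then have "(1 + 4 / 11 * ?a) / ?a \<le> sqrt (1 + ?a) / ?a"
        using a by (intro divide_right_mono) auto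
      then have "1 / ?a + 4 / 11 \<le> 1 / \<alpha> (Suc (k + m))"
        using a by (simp add: rec add_divide_distrib)
      then show ?case using Suc \<alpha>_dec[of "k + m"] by simp
    qed
    then show ?thesis ..
  qed
  show ?thesis
  proof (cases "\<alpha> 0 \<le> 2")
    case True
    have "4 / 11 * A \<le> 4 / 11 * real N" using N by simp
    also have "\<dots> \<le> 1 / \<alpha> (0 + N)" by (rule harmonic[OF True])
    finally show ?thesis by simp
  next
    case False
    have log_eq: "1 / 2 * log (3 / 2) ((\<alpha> 0)\<^sup>2 / 4) = log (3 / 2) (\<alpha> 0 / 2)"
      using log_nat_power[of "\<alpha> 0 / 2" "3 / 2" 2] pos by (simp add: power_divide)
    have log_pos: "0 < log (3 / 2) (\<alpha> 0 / 2)" using False by simp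
    \<comment> \<open>Enough steps for \<open>\<alpha> 0 * (2 / 3) ^ k \<le> 2\<close>; rounding up
      costs less than the \<open>1\<close> granted in \<open>N\<close>.\<close>
    define k where "k = nat \<lceil>log (3 / 2) (\<alpha> 0 / 2)\<rceil>"
    have k: "log (3 / 2) (\<alpha> 0 / 2) \<le> real k" "real k \<le> 1 + log (3 / 2) (\<alpha> 0 / 2)"
      using log_pos unfolding k_def by linarith+
    have kN: "A + real k \<le> real N" using N k log_pos unfolding log_eq by simp
    then have "k \<le> N" using A by simp
    have "\<alpha> 0 / 2 \<le> (3 / 2) powr real k"
      using k(1) pos by (simp add: log_le_iff)
    then have "\<alpha> 0 \<le> 2 * (3 / 2) ^ k" by (simp add: powr_realpow)
    then have "\<alpha> 0 * (2 / 3) ^ k \<le> 2 * (3 / 2) ^ k * (2 / 3) ^ k"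
      by (intro mult_right_mono) auto
    also have "\<dots> = 2" by (simp flip: power_mult_distrib)
    finally have "\<alpha> k \<le> 2" using geometric[of k] by simp
    have "4 / 11 * A \<le> 4 / 11 * real (N - k)" using kN \<open>k \<le> N\<close> by (simp add: of_nat_diff)
    also have "\<dots> \<le> 1 / \<alpha> (k + (N - k))" by (rule harmonic[OF \<open>\<alpha> k \<le> 2\<close>])
    finally show ?thesis using \<open>k \<le> N\<close> by simp
  qed
qed

section \<open>From extended-real functions to their real parts\<close>

text \<open>Expanding the derivative in the basis gives existence, and derivatives are unique, so
  the \<open>THE\<close> in \<open>gradient\<close> is well defined.\<close>

lemma GDERIV_gradient:
  assumes "(\<lambda>z. real_of_ereal (f z)) differentiable (at x)"
  shows "GDERIV (\<lambda>z. real_of_ereal (f z)) x :> gradient f x"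
proof -
  let ?F = "\<lambda>z. real_of_ereal (f z)"
  obtain D where D: "(?F has_derivative D) (at x)"
    using assms by (auto simp: differentiable_def)
  interpret bounded_linear D using D by (rule has_derivative_bounded_linear)
  define d where "d = (\<Sum>b\<in>Basis. D b *\<^sub>R b)"
  have "D h = h \<bullet> d" for h
  proof -
    have "D h = D (\<Sum>b\<in>Basis. (h \<bullet> b) *\<^sub>R b)" by (simp add: euclidean_representation)
    also have "\<dots> = h \<bullet> d" by (simp add: sum scaleR d_def inner_sum_right mult.commute)
    finally show ?thesis .
  qed
  then have "D = (\<lambda>h. h \<bullet> d)" by blast
  then have "GDERIV ?F x :> d" using D by (simp add: gderiv_def)
  moreover have "d' = d" if "GDERIV ?F x :> d'" for d'
  proof -
    have "(\<lambda>h. h \<bullet> d') = (\<lambda>h. h \<bullet> d)"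
      using that \<open>GDERIV ?F x :> d\<close> unfolding gderiv_def by (rule has_derivative_unique)
    then show ?thesis by (metis inner_commute vector_eq_rdot)
  qed
  ultimately show ?thesis unfolding gradient_def by (rule theI)
qed

lemma gradient_has_derivative_hessian:
  assumes "gradient f differentiable (at x)"
  shows "(gradient f has_derivative (\<lambda>v. hessian f x *v v)) (at x)"
  using assms unfolding hessian_def by (rule jacobian_works[THEN iffD1])

lemma norm_hessian_le: "norm (hessian f x *v v) \<le> spectral_norm (hessian f x) * norm v"
  unfolding spectral_norm_def by (rule onorm) (rule matrix_vector_mul_bounded_linear)

text \<open>The tangent inequality is the limit of chord inequalities at \<open>x\<close>. The
  remaining substantial point is \<open>no_escape\<close>: by continuity of \<open>f\<close> on the
  closure, a bound along the segment passes to its end, where \<open>f\<close> is then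
  finite.\<close>

lemma smooth_convex_real_part:
  fixes f :: "real ^ 'd \<Rightarrow> ereal"
  assumes f_no_minf: "\<And>x. f x \<noteq> -\<infinity>"
    and domain: "open (eff_domain f)" "convex (eff_domain f)"
    and f_convex: "convex_fun f" and f_smooth: "ell_smooth l f"
  shows "smooth_convex (eff_domain f) (\<lambda>x. real_of_ereal (f x)) (gradient f) l"
proof -
  let ?X = "eff_domain f" and ?F = "\<lambda>x. real_of_ereal (f x)" and ?g = "gradient f"
  have fF: "f x = ereal (?F x)" if "x \<in> ?X" for x
    using that f_no_minf[of x] by (cases "f x") (auto simp: eff_domain_def)
  have F_deriv: "(?F has_derivative (\<lambda>h. h \<bullet> ?g x)) (at x)" if "x \<in> ?X" for x
    using GDERIV_gradient[of f x] f_smooth that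
    by (simp add: ell_smooth_def twice_differentiable_on_domain_def gderiv_def)
  show ?thesis
  proof
    show "open ?X" "convex ?X" by (fact domain)+
    show "(?F has_derivative (\<lambda>h. h \<bullet> ?g x)) (at x)" if "x \<in> ?X" for x
      using that by (rule F_deriv)
    show "\<exists>H. (?g has_derivative H) (at x) \<and> (\<forall>v. norm (H v) \<le> l (norm (?g x)) * norm v)"
      if x: "x \<in> ?X" for x
    proof (intro exI conjI allI)
      show "(?g has_derivative (\<lambda>v. hessian f x *v v)) (at x)"
        using f_smooth x
        by (intro gradient_has_derivative_hessian)
          (simp add: ell_smooth_def twice_differentiable_on_domain_def)
      fix v
      have "spectral_norm (hessian f x) \<le> l (norm (?g x))"
        using f_smooth x by (simp add: ell_smooth_def)
      then show "norm (hessian f x *v v) \<le> l (norm (?g x)) * norm v"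
        using order_trans[OF norm_hessian_le mult_right_mono[OF _ norm_ge_zero]] by blast
    qed
    show "?F x + ?g x \<bullet> (y - x) \<le> ?F y" if x: "x \<in> ?X" and y: "y \<in> ?X" for x y
    proof -
      let ?\<phi> = "\<lambda>s. ?F (x + s *\<^sub>R (y - x))"
      have "(?\<phi> has_derivative (\<lambda>s. (s *\<^sub>R (y - x)) \<bullet> ?g x)) (at 0)"
        by (rule has_derivative_compose[of "\<lambda>s. x + s *\<^sub>R (y - x)" "\<lambda>s. s *\<^sub>R (y - x)"])
          (auto intro!: derivative_eq_intros F_deriv x)
      then have "(?\<phi> has_real_derivative (?g x \<bullet> (y - x))) (at 0)"
        by (rule has_derivative_imp_has_field_derivative) (simp add: inner_commute)
      then have "((\<lambda>s. (?\<phi> s - ?\<phi> 0) / s) \<longlongrightarrow> ?g x \<bullet> (y - x)) (at_right 0)"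
        unfolding DERIV_def by (simp add: filterlim_at_split)
      moreover have "\<forall>\<^sub>F s in at_right 0. (?\<phi> s - ?\<phi> 0) / s \<le> ?F y - ?F x"
        using eventually_at_right_real[OF zero_less_one]
      proof eventually_elim
        case (elim s)
        then have s: "0 < s" "s < 1" by auto
        have eq: "x + s *\<^sub>R (y - x) = s *\<^sub>R y + (1 - s) *\<^sub>R x" by (simp add: algebra_simps)
        have "x + s *\<^sub>R (y - x) \<in> ?X"
          unfolding eq using s by (intro convexD[OF domain(2) y x]) auto
        moreover have "f (x + s *\<^sub>R (y - x)) \<le> ereal s * f y + ereal (1 - s) * f x"
          unfolding eq using f_convex s by (simp add: convex_fun_def)
        moreover obtain a b where "f x = ereal a" "f y = ereal b" using fF x y by blast
        ultimately have "?\<phi> s \<le> s * ?F y + (1 - s) * ?F x"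
          using fF[of "x + s *\<^sub>R (y - x)"] by (cases "f (x + s *\<^sub>R (y - x))") auto
        then show ?case using s by (simp add: field_simps)
      qed
      ultimately have "?g x \<bullet> (y - x) \<le> ?F y - ?F x"
        by (rule tendsto_upperbound) simp
      then show ?thesis by simp
    qed
    show "x + T *\<^sub>R v \<in> ?X"
      if T: "0 < T" and *: "\<And>s. 0 \<le> s \<Longrightarrow> s < T \<Longrightarrow> x + s *\<^sub>R v \<in> ?X \<and> ?F (x + s *\<^sub>R v) \<le> C"
      for T x v C
    proof -
      have lim: "((\<lambda>s. x + s *\<^sub>R v) \<longlongrightarrow> x + T *\<^sub>R v) (at_left T)" by (intro tendsto_intros)
      have ev: "\<forall>\<^sub>F s in at_left T. x + s *\<^sub>R v \<in> ?X \<and> ?F (x + s *\<^sub>R v) \<le> C"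
        using eventually_at_left_real[OF T] by eventually_elim (use * in auto)
      have cl: "\<forall>\<^sub>F s in at_left T. x + s *\<^sub>R v \<in> closure ?X"
        using ev by eventually_elim (use closure_subset in auto)
      have "x + T *\<^sub>R v \<in> closure ?X"
        by (rule Lim_in_closed_set[OF closed_closure cl _ lim]) simp
      moreover have "continuous_on (closure ?X) f" using f_smooth by (simp add: ell_smooth_def)
      ultimately have "((\<lambda>s. f (x + s *\<^sub>R v)) \<longlongrightarrow> f (x + T *\<^sub>R v)) (at_left T)"
        using lim cl by (intro continuous_on_tendsto_compose[of "closure ?X" f])
      moreover have "\<forall>\<^sub>F s in at_left T. f (x + s *\<^sub>R v) \<le> ereal C"
        using ev by eventually_elim (metis fF ereal_less_eq(3))
      ultimately have "f (x + T *\<^sub>R v) \<le> ereal C"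
        by (rule tendsto_upperbound) simp
      then show ?thesis by (auto simp: eff_domain_def)
    qed
    show "mono_on {0..} l" using f_smooth by (simp add: ell_smooth_def)
    show "0 < l s" if "0 \<le> s" for s using f_smooth that by (simp add: ell_smooth_def)
    have "local_lipschitz (UNIV :: real set) {0..} (\<lambda>_. l)"
      using f_smooth by (simp add: ell_smooth_def)
    then show "continuous_on {0..} l"
      by (rule local_lipschitz_continuous_on[OF _ UNIV_I])
  qed
qed

section \<open>Counting the gradient calls of both phases\<close>

theorem theorem3p3:
  fixes f :: "real ^ 'd \<Rightarrow> ereal"
    and l :: "real \<Rightarrow> real"
    and x0 xstar :: "real ^ 'd"
    and Rbar \<epsilon> \<delta> :: real
  assumes f_no_minf: "\<And>x. f x \<noteq> -\<infinity>"
    and domain: "open (eff_domain f)" "convex (eff_domain f)"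
    and f_convex: "convex_fun f"
    and f_smooth: "ell_smooth l f"
    and minimum: "\<And>x. f xstar \<le> f x"
    and x0: "x0 \<in> eff_domain f"
    and psi: "strict_mono_on {0..} (\<lambda>x. x\<^sup>2 / (2 * l (4 * x)))"
    and Rbar: "Rbar > 0" "norm (x0 - xstar) \<le> Rbar"
    and eps: "\<epsilon> > 0"
    and delta: "\<delta> \<ge> 0" "l (8 * sqrt (\<delta> * l 0)) \<le> 2 * l 0"
  shows "alg1_complexity f l x0 xstar \<delta> Rbar \<epsilon>
           \<le> round_up (ereal (5 * sqrt (l 0) * Rbar / sqrt \<epsilon>)
                         + k_bound f l x0 xstar Rbar \<delta>)"
proof (cases "k_GD f l x0 xstar \<delta>")
  case infinity
  have "k_bound f l x0 xstar Rbar \<delta> = \<infinity>"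
    by (simp add: k_bound_def infinity)
  then show ?thesis by (auto simp: round_up_def intro!: Inf_greatest)
next
  case (enat K)
  let ?X = "eff_domain f" and ?F = "\<lambda>x. real_of_ereal (f x)" and ?g = "gradient f"
  \<comment> \<open>Then \<open>4 * t\<close> is the argument of \<open>l\<close> in
    \<open>delta\<close>, and \<open>t\<^sup>2 / (4 * l 0) = \<delta>\<close>.\<close>
  define t where "t = 2 * sqrt (\<delta> * l 0)"
  define \<gamma> where "\<gamma> = 1 / (2 * l 0)"
  interpret S: smooth_convex ?X ?F ?g l
    by (rule smooth_convex_real_part[OF f_no_minf domain f_convex f_smooth])
  have l0: "0 < l 0" by (rule S.l_pos) simp
  have xsX: "xstar \<in> ?X"
    using minimum[of x0] x0 by (auto simp: eff_domain_def)
  have fF: "f x = ereal (?F x)" if "x \<in> ?X" for x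
    using that f_no_minf[of x] by (cases "f x") (auto simp: eff_domain_def)
  have Fmin: "?F xstar \<le> ?F x" if "x \<in> ?X" for x
    using minimum[of x] by (metis fF that xsX ereal_less_eq(3))
  interpret A: accelerated ?X ?F ?g l xstar \<delta> t \<gamma>
  proof
    show "l (4 * t) \<le> 2 * l 0" using delta(2) by (simp add: t_def)
    have "\<delta> = t\<^sup>2 / (2 * (2 * l 0))" using delta(1) l0 by (simp add: t_def)
    also have "\<dots> \<le> t\<^sup>2 / (2 * l (4 * t))"
      using \<open>l (4 * t) \<le> 2 * l 0\<close> l0 delta(1)
      by (intro divide_left_mono mult_pos_pos S.l_pos) (auto simp: t_def)
    finally show "\<delta> \<le> t\<^sup>2 / (2 * l (4 * t))" .
    show "0 \<le> t" using delta(1) l0 by (simp add: t_def)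
  qed (use xsX Fmin psi \<gamma>_def in auto)
  have gap_iff: "f x - f xstar \<le> ereal c \<longleftrightarrow> ?F x - ?F xstar \<le> c" if "x \<in> ?X" for x c
    by (subst (1 2) fF) (use that xsX in auto)
  have eps_iff: "eps_solution f \<epsilon> x \<longleftrightarrow> ?F x - ?F xstar \<le> \<epsilon>" if "x \<in> ?X" for x
  proof -
    have "(INF z. f z) = f xstar"
      by (rule antisym) (auto intro: INF_lower INF_greatest minimum)
    then show ?thesis using gap_iff[OF that] by (simp add: eps_solution_def)
  qed
  have gd: "gd f l x0 j \<in> ?X \<and> norm (gd f l x0 j - xstar) \<le> Rbar" for j
  proof (induction j)
    case (Suc j)
    then show ?case
      using A.gd_step[of "gd f l x0 j", OF _ gd_step_size_def] by auto
  qed (use x0 Rbar in simp)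
  define xbar where "xbar = gd f l x0 K"
  have xbar: "xbar \<in> ?X" "norm (xbar - xstar) \<le> Rbar" using gd by (auto simp: xbar_def)
  have gap_xbar: "?F xbar - ?F xstar \<le> \<delta> / 2"
  proof -
    let ?S = "{enat j | j. f (gd f l x0 j) - f xstar \<le> ereal (\<delta> / 2)}"
    \<comment> \<open>The infimum of the empty set is infinite, so a finite \<open>k_GD\<close> is
      attained by an iterate.\<close>
    have "?S \<noteq> {}" using enat unfolding k_GD_def by (metis Inf_enat_def enat.distinct(1))
    then have "Inf ?S \<in> ?S" by (auto simp: Inf_enat_def intro: LeastI)
    then have "enat K \<in> ?S" using enat by (simp add: k_GD_def)
    then show ?thesis using gap_iff[OF xbar(1)] by (simp add: xbar_def)
  qed
  define ph where "ph = phase2 f l \<delta> Rbar xbar"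
  define B where "B = 5 * sqrt (l 0) * Rbar / sqrt \<epsilon>"
  have B: "0 \<le> B" using Rbar l0 eps by (simp add: B_def)
  define m where "m = max (1 + ereal (1 / 2) * elog (3 / 2) (\<delta> / (8 * l 0 * Rbar\<^sup>2))) 0"
  \<comment> \<open>For \<open>\<delta> = 0\<close> the point \<open>xbar\<close> is already a
    minimizer, so no accelerated step is taken.\<close>
  have key: "(\<forall>k<N. fst (ph k) \<in> ?X) \<and> eps_solution f \<epsilon> (fst (ph N))"
    if N: "\<delta> > 0 \<Longrightarrow> ereal B + m \<le> ereal (real N)" and N0: "\<delta> = 0 \<Longrightarrow> N = 0" for N
  proof (cases "\<delta> = 0")
    case True
    then have "N = 0" by (rule N0)
    then show ?thesis using gap_xbar eps True xbar eps_iff[of xbar] by (simp add: ph_def)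
  next
    case False
    then have \<delta>: "0 < \<delta>" using delta by simp
    define C where "C = Rbar\<^sup>2"
    have C: "0 < C" using Rbar by (simp add: C_def)
    define inv where "inv y u \<Gamma> \<longleftrightarrow> y \<in> ?X \<and> ?F y - ?F xstar < \<delta> \<and> u \<in> closure ?X \<and> 0 < \<Gamma>
      \<and> C * \<Gamma> \<le> \<delta> \<and> A.energy y u \<Gamma> \<le> C * \<Gamma> \<and> ?F y - ?F xstar \<le> C * \<Gamma>" for y u \<Gamma>
    define \<Gamma> where "\<Gamma> k = snd (snd (ph k))" for k
    define \<alpha> where "\<alpha> k = sqrt (\<gamma> * \<Gamma> k)" for k
    have \<Gamma>_Suc: "\<Gamma> (Suc k) = \<Gamma> k / (1 + \<alpha> k)" for k
      by (simp add: \<Gamma>_def \<alpha>_def ph_def \<gamma>_def Let_def split: prod.split)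
    have inv: "inv (fst (ph k)) (fst (snd (ph k))) (\<Gamma> k)" for k
    proof (induction k)
      case 0
      \<comment> \<open>Half of \<open>\<delta>\<close> covers the distance term, as gradient
        descent stays within \<open>Rbar\<close> of \<open>xstar\<close>; the other half covers the
        gap at \<open>xbar\<close>.\<close>
      have "\<delta> / Rbar\<^sup>2 / 2 * (norm (xbar - xstar))\<^sup>2 \<le> \<delta> / Rbar\<^sup>2 / 2 * Rbar\<^sup>2"
        using xbar \<delta> by (intro mult_left_mono power_mono) auto
      also have "\<dots> = \<delta> / 2" using Rbar by simp
      finally have "A.energy xbar xbar (\<delta> / Rbar\<^sup>2) \<le> \<delta>"
        using gap_xbar A.\<gamma>_pos unfolding A.energy_def
        by (smt (verit) field_sum_of_halves mult_nonneg_nonneg zero_le_power2 half_gt_zero)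
      moreover have "C * (\<delta> / Rbar\<^sup>2) = \<delta>" using Rbar by (simp add: C_def)
      moreover have "xbar \<in> closure ?X" using xbar closure_subset by blast
      ultimately show ?case
        using xbar gap_xbar \<delta> Rbar by (simp add: inv_def ph_def \<Gamma>_def)
    next
      case (Suc k)
      obtain y u where yu: "ph k = (y, u, \<Gamma> k)" by (metis \<Gamma>_def prod.collapse)
      obtain y' u' where yu': "ph (Suc k) = (y', u', \<Gamma> (Suc k))" by (metis \<Gamma>_def prod.collapse)
      have y': "y' = (1 / (1 + \<alpha> k)) *\<^sub>R y + (\<alpha> k / (1 + \<alpha> k)) *\<^sub>R u - (\<gamma> / (1 + \<alpha> k)) *\<^sub>R ?g y"
        using yu' yu by (simp add: ph_def Let_def \<alpha>_def \<gamma>_def)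
      have u': "u' = closest_point (closure ?X) (u - (\<alpha> k / \<Gamma> k) *\<^sub>R ?g y')"
        using yu' yu unfolding y' by (simp add: ph_def Let_def \<alpha>_def \<gamma>_def)
      have "inv y u (\<Gamma> k)" using Suc yu by simp
      then have "inv y' u' (\<Gamma> (Suc k))"
        using A.accelerated_step[OF _ _ _ \<alpha>_def _ C _ _ y' u' \<Gamma>_Suc] unfolding inv_def by blast
      then show ?case by (simp add: yu')
    qed
    have \<Gamma>_pos: "0 < \<Gamma> k" for k using inv[of k] by (simp add: inv_def)
    have \<alpha>_Suc: "\<alpha> (Suc k) = \<alpha> k / sqrt (1 + \<alpha> k)" for k
      unfolding \<alpha>_def[of "Suc k"] \<Gamma>_Suc by (simp add: real_sqrt_divide \<alpha>_def)
    have \<alpha>_sq: "(\<alpha> k)\<^sup>2 = \<Gamma> k / (2 * l 0)" for k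
      using \<Gamma>_pos[of k] l0 by (simp add: \<alpha>_def \<gamma>_def)
    have \<alpha>_pos: "0 < \<alpha> k" for k using \<Gamma>_pos[of k] A.\<gamma>_pos by (simp add: \<alpha>_def)
    have "\<delta> / (8 * l 0 * Rbar\<^sup>2) = (\<alpha> 0)\<^sup>2 / 4"
      unfolding \<alpha>_sq by (simp add: \<Gamma>_def ph_def)
    then have "ereal B + m = ereal (B + max (1 + 1 / 2 * log (3 / 2) ((\<alpha> 0)\<^sup>2 / 4)) 0)"
      unfolding m_def using \<alpha>_pos[of 0]
      by (simp only:) (simp add: elog_def max_def one_ereal_def zero_ereal_def)
    then have "4 / 11 * B \<le> 1 / \<alpha> N"
      using N[OF \<delta>] by (intro alpha_decay \<alpha>_pos \<alpha>_Suc B) simp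
    then have "(4 / 11 * B)\<^sup>2 \<le> (1 / \<alpha> N)\<^sup>2" using B by (intro power_mono) auto
    moreover have "B\<^sup>2 = 25 * l 0 * C / \<epsilon>"
      using l0 eps by (simp add: B_def C_def power_divide power_mult_distrib)
    moreover have "(1 / \<alpha> N)\<^sup>2 = 2 * l 0 / \<Gamma> N" by (simp add: power_divide \<alpha>_sq)
    \<comment> \<open>The constant 5 suffices: \<open>(4 / 11 * 5)\<^sup>2 = 400 / 121\<close>
      exceeds 2, which gives \<open>C * \<Gamma> N \<le> 121 / 200 * \<epsilon>\<close>.\<close>
    ultimately have "16 / 121 * (25 * l 0 * C / \<epsilon>) \<le> 2 * l 0 / \<Gamma> N"
      by (simp add: power_mult_distrib power_divide)
    then have "l 0 * (200 * (C * \<Gamma> N)) \<le> l 0 * (121 * \<epsilon>)"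
      using \<Gamma>_pos[of N] eps by (simp add: field_simps)
    then have "C * \<Gamma> N \<le> \<epsilon>" using l0 eps by simp
    then show ?thesis using inv by (auto simp: inv_def eps_iff intro: order_trans)
  qed
  have m0: "0 \<le> m" by (simp add: m_def)
  show ?thesis unfolding round_up_def
  proof (rule Inf_greatest, clarify)
    fix n
    assume n: "ereal (5 * sqrt (l 0) * Rbar / sqrt \<epsilon>) + k_bound f l x0 xstar Rbar \<delta>
      \<le> ereal_of_enat n"
    show "alg1_complexity f l x0 xstar \<delta> Rbar \<epsilon> \<le> n"
    proof (cases n)
      case (enat n')
      have n': "ereal B + m + ereal (real K) \<le> ereal (real n')"
        using n \<open>k_GD f l x0 xstar \<delta> = enat K\<close>
        by (simp add: enat k_bound_def B_def m_def add.assoc)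
      moreover have "ereal (real K) \<le> ereal B + m + ereal (real K)"
        using B m0 by (simp add: add_increasing)
      ultimately have "K \<le> n'" using order_trans by fastforce
      \<comment> \<open>For positive \<open>\<delta>\<close>, the budget left after the
        \<open>K\<close> calls of the first phase.\<close>
      define N where "N = (if \<delta> = 0 then 0 else n' - K)"
      have "ereal B + m \<le> ereal (real (n' - K))"
        using n' \<open>K \<le> n'\<close> by (cases m) (auto simp: of_nat_diff)
      then have "(\<forall>k<N. fst (ph k) \<in> ?X) \<and> eps_solution f \<epsilon> (fst (ph N))"
        by (intro key) (auto simp: N_def)
      then have "alg1_complexity f l x0 xstar \<delta> Rbar \<epsilon> \<le> enat K + enat N"
        using gd unfolding alg1_complexity_def Let_def \<open>k_GD f l x0 xstar \<delta> = enat K\<close>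
        by (intro Inf_lower) (auto simp: ph_def xbar_def)
      also have "\<dots> \<le> n" using \<open>K \<le> n'\<close> by (simp add: enat N_def)
      finally show ?thesis .
    qed simp
  qed
qed

end
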